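(* Consider the problem $f_0^*=\min_{x\in Q}\{f_0(x):\ f_i(x)\le0,\ i=1,\dots,m\}$, with an optimal solution $x^*$, and assume that the dual problem $\sup_{\bar\lambda\in\mathbb{R}^m_+}\phi(\bar\lambda)=f_0^*$ has an optimal solution $\bar\lambda^*\in\mathbb{R}^m_+$. Let $\|f_i'(x)\|_*\le M_i$ for all $x\in Q$ and $i=0,\dots,m$ (with $M_i>0$), and $\bar M=(M_1,\dots,M_m)^T$. Let $\{x_k\}_{k\ge0}$ be generated by either Method I or Method II described in the context, with step bounds $h_k=\sqrt{2D}\,\tau_k$, $k\ge0$, where $\tau_k\ge\tau_{k+1}>0$ for all $k\ge0$ and $\sum_{k=0}^\infty\tau_k^2=+\infty$. Let $a(\cdot)$ be the divergence delay of $\{\tau_k\}$. Then for all $N\ge1+a(0)$, with $k(N)=\max\{k\ge0:\ k+a(k)\le N-1\}$, $$f_0^*-\phi(\bar\lambda^*(N))\ \le\ \big(M_0+\langle\bar\lambda^*,\bar M\rangle\big)\,h_{k(N)}.$$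
   Context: $\mathbb{E}$ is a finite-dimensional real vector space with dual $\mathbb{E}^*$, $\langle s,x\rangle$ is the value of $s\in\mathbb{E}^*$ at $x$ (also the standard inner product on $\mathbb{R}^m$), $\|\cdot\|$ is an arbitrary norm on $\mathbb{E}$ and $\|g\|_*=\max\{\langle g,x\rangle:\|x\|\le1\}$. The functions $f_0,\dots,f_m$ are closed, convex and subdifferentiable on $Q$; $Q\subset\mathbb{E}$ is closed, convex and bounded; $f_i'(x)$ is a fixed subgradient of $f_i$ at $x\in Q$. Write $\bar f(x)=(f_1(x),\dots,f_m(x))^T$. Prox-function: $d$ is continuously differentiable on a convex open domain $\mathrm{dom}\,d\supseteq Q$ with $d(y)\ge d(x)+\langle\nabla d(x),y-x\rangle+\frac12\|y-x\|^2$. Bregman distance: $\beta_d(x,y)=d(y)-d(x)-\langle\nabla d(x),y-x\rangle$. The constant $D$ satisfies $\beta_d(x,y)<D$ for all $x,y\in Q$. Dual function: $\phi(\bar\lambda)=\min_{x\in Q}\{f_0(x)+\langle\bar\lambda,\bar f(x)\rangle\}$, $\bar\lambda\in\mathbb{R}^m_+$. For $x\in Q$, $\lambda\ge0$, $i=0,\dots,m$: $\varphi_{i,x}(\lambda)=\max_{T\in Q}\{\lambda\langle f_i'(x),x-T\rangle-\beta_d(x,T)\}$, with maximizer $T_{i,x}(\lambda)$. The number $\lambda_{i,k}>0$ is a solution of $\varphi_{i,x_k}(\lambda_{i,k})=\frac12h_k^2$. For $1\le i\le m$, $\hat T_i(x_k)=\arg\min_{T\in Q}\{\beta_d(x_k,T):\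 f_i(x_k)+\langle f_i'(x_k),T-x_k\rangle\le0\}$, and $\lambda_i(x_k)\ge0$ is the optimal Lagrange multiplier for the linear inequality constraint of this problem: with $T=\hat T_i(x_k)$, $\langle\nabla d(T)-\nabla d(x_k)+\lambda_i(x_k)f_i'(x_k),x-T\rangle\ge0$ for all $x\in Q$, and $\lambda_i(x_k)\,[f_i(x_k)+\langle f_i'(x_k),T-x_k\rangle]=0$. All these solutions $\lambda_{i,k}$ and multipliers $\lambda_i(x_k)$ are assumed to exist whenever needed by the method. Method I: choose $x_0\in Q$. For $k\ge0$: (1) compute $r_k^i=\beta_d(x_k,\hat T_i(x_k))$, $1\le i\le m$. (2) If there is $i\in\{1,\dots,m\}$ with $r_k^i\ge\frac12h_k^2$, pick such an $i$ and set $i_k=i$, $\lambda_k=\lambda_i(x_k)$, $x_{k+1}=\hat T_i(x_k)$. (3) Otherwise set $i_k=0$, $\lambda_k=\lambda_{0,k}$, $x_{k+1}=T_{0,x_k}(\lambda_{0,k})$. Method II: choose $x_0\in Q$. For $k\ge0$: (1) compute $\lambda_{i,k}$ for $1\le i\le m$. (2) If there is $i\in\{1,\dots,m\}$ with $\lambda_{i,k}f_i(x_k)\ge h_k^2$, pick such an $i$ and set $i_k=i$; otherwise set $i_k=0$. (3) Set $\lambda_k=\lambda_{i_k,k}$ and $x_{k+1}=T_{i_k,x_k}(\lambda_k)$. Divergence delay: $a(k)\ge0$ is the minimal nonnegative integer such that $\sum_{i=k}^{k+a(k)}\tau_i^2\ge1$. Further notation: $\mathcal{A}_i(N)=\{k:\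 k(N)\le k\le N-1,\ i_k=i\}$ and $\sigma_i(N)=\sum_{k\in\mathcal{A}_i(N)}\lambda_k$ for $i=0,\dots,m$ (empty sums are zero); $\lambda_i^*(N)=\sigma_i(N)/\sigma_0(N)$ for $i=1,\dots,m$, and $\bar\lambda^*(N)=(\lambda_1^*(N),\dots,\lambda_m^*(N))$ (in this setting $\mathcal{A}_0(N)\neq\emptyset$ and $\sigma_0(N)>0$). *)

theory Defs
  imports "HOL-Analysis.Analysis"
begin

text \<open>
  Conventions. The primal space is a type of class \<open>real_normed_vector\<close> (assumed
  finite-dimensional where needed), whose \<open>norm\<close> is the arbitrary norm of the space. The dual space
  is the type of bounded linear functionals; its \<open>norm\<close> is the operator norm, i.e. the dual norm.
  The functions are \<open>f 0, \<dots>, f m\<close>, with subgradients \<open>f' i x\<close>; values of \<open>f i\<close> outside \<open>Q\<close> are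
  never used. A vector of \<open>\<real>\<^sup>m\<close> is represented by its components \<open>1, \<dots>, m\<close>: a function
  \<open>nat \<Rightarrow> real\<close> whose values at other indices are irrelevant.
\<close>

definition is_subgradient ::
  "'a::real_normed_vector set \<Rightarrow> ('a \<Rightarrow> real) \<Rightarrow> ('a \<Rightarrow>\<^sub>L real) \<Rightarrow> 'a \<Rightarrow> bool" where
  "is_subgradient Q f g x \<longleftrightarrow> (\<forall>y\<in>Q. f y \<ge> f x + g (y - x))"

definition nonneg_orthant :: "nat \<Rightarrow> (nat \<Rightarrow> real) set" where
  "nonneg_orthant m = {l. \<forall>i\<in>{1..m}. 0 \<le> l i}"

definition feasible_set :: "'a set \<Rightarrow> nat \<Rightarrow> (nat \<Rightarrow> 'a \<Rightarrow> real) \<Rightarrow> 'a set" where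
  "feasible_set Q m f = {x\<in>Q. \<forall>i\<in>{1..m}. f i x \<le> 0}"

definition dual_fun ::
  "'a set \<Rightarrow> nat \<Rightarrow> (nat \<Rightarrow> 'a \<Rightarrow> real) \<Rightarrow> (nat \<Rightarrow> real) \<Rightarrow> real" where
  "dual_fun Q m f l = (INF x\<in>Q. f 0 x + (\<Sum>i=1..m. l i * f i x))"

text \<open>A prox-function \<open>d\<close> with open convex domain \<open>U\<close> and gradient map \<open>gd\<close>, strongly convex with
  parameter one with respect to \<open>norm\<close>.\<close>

definition prox_function ::
  "'a::real_normed_vector set \<Rightarrow> ('a \<Rightarrow> real) \<Rightarrow> ('a \<Rightarrow> 'a \<Rightarrow>\<^sub>L real) \<Rightarrow> bool" where
  "prox_function U d gd \<longleftrightarrow>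
     open U \<and> convex U \<and>
     (\<forall>x\<in>U. (d has_derivative blinfun_apply (gd x)) (at x)) \<and> continuous_on U gd \<and>
     (\<forall>x\<in>U. \<forall>y\<in>U. d y \<ge> d x + gd x (y - x) + (norm (y - x))\<^sup>2 / 2)"

definition bregman ::
  "('a::real_normed_vector \<Rightarrow> real) \<Rightarrow> ('a \<Rightarrow> 'a \<Rightarrow>\<^sub>L real) \<Rightarrow> 'a \<Rightarrow> 'a \<Rightarrow> real" where
  "bregman d gd x y = d y - d x - gd x (y - x)"

text \<open>In the next two definitions, \<open>g\<close> stands for a subgradient \<open>f' i x\<close>: they are
  \<open>\<phi>\<^sub>i\<^sub>,\<^sub>x(\<lambda>)\<close> and its maximizer \<open>T\<^sub>i\<^sub>,\<^sub>x(\<lambda>)\<close>. By strong convexity of \<open>d\<close> and compactness of \<open>Q\<close>, the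
  extremal points selected by \<open>arg_max_on\<close> and \<open>arg_min_on\<close> below exist and are unique
  (for \<open>cut_proj\<close>, as soon as its constraint set is nonempty).\<close>

definition prox_max ::
  "'a::real_normed_vector set \<Rightarrow> ('a \<Rightarrow> real) \<Rightarrow> ('a \<Rightarrow> 'a \<Rightarrow>\<^sub>L real) \<Rightarrow> ('a \<Rightarrow>\<^sub>L real) \<Rightarrow> 'a \<Rightarrow> real \<Rightarrow> real"
  where
  "prox_max Q d gd g x lam = (SUP T\<in>Q. lam * g (x - T) - bregman d gd x T)"

definition prox_step ::
  "'a::real_normed_vector set \<Rightarrow> ('a \<Rightarrow> real) \<Rightarrow> ('a \<Rightarrow> 'a \<Rightarrow>\<^sub>L real) \<Rightarrow> ('a \<Rightarrow>\<^sub>L real) \<Rightarrow> 'a \<Rightarrow> real \<Rightarrow> 'a"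
  where
  "prox_step Q d gd g x lam = arg_max_on (\<lambda>T. lam * g (x - T) - bregman d gd x T) Q"

definition is_step_size ::
  "'a::real_normed_vector set \<Rightarrow> ('a \<Rightarrow> real) \<Rightarrow> ('a \<Rightarrow> 'a \<Rightarrow>\<^sub>L real) \<Rightarrow> ('a \<Rightarrow>\<^sub>L real) \<Rightarrow> 'a \<Rightarrow> real \<Rightarrow> real
     \<Rightarrow> bool" where
  "is_step_size Q d gd g x h lam \<longleftrightarrow> lam > 0 \<and> prox_max Q d gd g x lam = h\<^sup>2 / 2"

text \<open>For a single constraint with value \<open>v = f i x\<close> and subgradient \<open>g = f' i x\<close> at \<open>x\<close>:
  the Bregman projection \<open>cut_proj\<close> of \<open>x\<close> onto the linearized constraint in \<open>Q\<close>, and the optimality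
  conditions saying that \<open>lam\<close> is a Lagrange multiplier of that constraint.\<close>

definition cut_proj ::
  "'a::real_normed_vector set \<Rightarrow> ('a \<Rightarrow> real) \<Rightarrow> ('a \<Rightarrow> 'a \<Rightarrow>\<^sub>L real) \<Rightarrow> real \<Rightarrow> ('a \<Rightarrow>\<^sub>L real) \<Rightarrow> 'a \<Rightarrow> 'a"
  where
  "cut_proj Q d gd v g x = arg_min_on (bregman d gd x) {T\<in>Q. v + g (T - x) \<le> 0}"

definition is_cut_multiplier ::
  "'a::real_normed_vector set \<Rightarrow> ('a \<Rightarrow> real) \<Rightarrow> ('a \<Rightarrow> 'a \<Rightarrow>\<^sub>L real) \<Rightarrow> real \<Rightarrow> ('a \<Rightarrow>\<^sub>L real) \<Rightarrow> 'a \<Rightarrow> real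
     \<Rightarrow> bool" where
  "is_cut_multiplier Q d gd v g x lam \<longleftrightarrow>
     lam \<ge> 0 \<and>
     (let T = cut_proj Q d gd v g x in
        (\<forall>y\<in>Q. blinfun_apply (gd T - gd x + lam *\<^sub>R g) (y - T) \<ge> 0) \<and>
        lam * (v + g (T - x)) = 0)"

text \<open>The sequences \<open>x k\<close> (iterates), \<open>idx k\<close> (the indices \<open>i\<^sub>k\<close>) and \<open>lam k\<close> (the
  \<open>\<lambda>\<^sub>k\<close>) are generated by the respective method with step bounds \<open>h k\<close>. The methods leave the choice
  of the violated constraint free. Solutions \<open>\<lambda>\<^sub>i\<^sub>,\<^sub>k\<close> and multipliers are required only at the
  indices for which the method uses them.\<close>

definition method_I ::
  "'a::real_normed_vector set \<Rightarrow> nat \<Rightarrow> (nat \<Rightarrow> 'a \<Rightarrow> real) \<Rightarrow> (nat \<Rightarrow> 'a \<Rightarrow> 'a \<Rightarrow>\<^sub>L real) \<Rightarrow>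
   ('a \<Rightarrow> real) \<Rightarrow> ('a \<Rightarrow> 'a \<Rightarrow>\<^sub>L real) \<Rightarrow> (nat \<Rightarrow> real) \<Rightarrow>
   (nat \<Rightarrow> 'a) \<Rightarrow> (nat \<Rightarrow> nat) \<Rightarrow> (nat \<Rightarrow> real) \<Rightarrow> bool" where
  "method_I Q m f f' d gd h x idx lam \<longleftrightarrow>
     x 0 \<in> Q \<and>
     (\<forall>k. let That = (\<lambda>i. cut_proj Q d gd (f i (x k)) (f' i (x k)) (x k));
              r = (\<lambda>i. bregman d gd (x k) (That i))
          in if \<exists>i\<in>{1..m}. r i \<ge> (h k)\<^sup>2 / 2
             then idx k \<in> {1..m} \<and> r (idx k) \<ge> (h k)\<^sup>2 / 2 \<and>
                  is_cut_multiplier Q d gd (f (idx k) (x k)) (f' (idx k) (x k)) (x k) (lam k) \<and>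
                  x (Suc k) = That (idx k)
             else idx k = 0 \<and>
                  is_step_size Q d gd (f' 0 (x k)) (x k) (h k) (lam k) \<and>
                  x (Suc k) = prox_step Q d gd (f' 0 (x k)) (x k) (lam k))"

text \<open>Below, \<open>l i\<close> is the number \<open>\<lambda>\<^sub>i\<^sub>,\<^sub>k\<close>.\<close>

definition method_II ::
  "'a::real_normed_vector set \<Rightarrow> nat \<Rightarrow> (nat \<Rightarrow> 'a \<Rightarrow> real) \<Rightarrow> (nat \<Rightarrow> 'a \<Rightarrow> 'a \<Rightarrow>\<^sub>L real) \<Rightarrow>
   ('a \<Rightarrow> real) \<Rightarrow> ('a \<Rightarrow> 'a \<Rightarrow>\<^sub>L real) \<Rightarrow> (nat \<Rightarrow> real) \<Rightarrow>
   (nat \<Rightarrow> 'a) \<Rightarrow> (nat \<Rightarrow> nat) \<Rightarrow> (nat \<Rightarrow> real) \<Rightarrow> bool" where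
  "method_II Q m f f' d gd h x idx lam \<longleftrightarrow>
     x 0 \<in> Q \<and>
     (\<forall>k. \<exists>l :: nat \<Rightarrow> real.
        (\<forall>i\<in>{1..m}. is_step_size Q d gd (f' i (x k)) (x k) (h k) (l i)) \<and>
        (if \<exists>i\<in>{1..m}. l i * f i (x k) \<ge> (h k)\<^sup>2
         then idx k \<in> {1..m} \<and> l (idx k) * f (idx k) (x k) \<ge> (h k)\<^sup>2
         else idx k = 0 \<and> is_step_size Q d gd (f' 0 (x k)) (x k) (h k) (l 0)) \<and>
        lam k = l (idx k) \<and>
        x (Suc k) = prox_step Q d gd (f' (idx k) (x k)) (x k) (lam k))"

definition divergence_delay :: "(nat \<Rightarrow> real) \<Rightarrow> nat \<Rightarrow> nat" where
  "divergence_delay tau k = (LEAST a. (\<Sum>i=k..k + a. (tau i)\<^sup>2) \<ge> 1)"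

definition start_index :: "(nat \<Rightarrow> real) \<Rightarrow> nat \<Rightarrow> nat" where
  "start_index tau N = Max {k. k + divergence_delay tau k \<le> N - 1}"

definition step_indices :: "(nat \<Rightarrow> real) \<Rightarrow> (nat \<Rightarrow> nat) \<Rightarrow> nat \<Rightarrow> nat \<Rightarrow> nat set" where
  "step_indices tau idx N i = {k. start_index tau N \<le> k \<and> k \<le> N - 1 \<and> idx k = i}"

definition step_sum ::
  "(nat \<Rightarrow> real) \<Rightarrow> (nat \<Rightarrow> nat) \<Rightarrow> (nat \<Rightarrow> real) \<Rightarrow> nat \<Rightarrow> nat \<Rightarrow> real" where
  "step_sum tau idx lam N i = (\<Sum>k\<in>step_indices tau idx N i. lam k)"

definition approx_multipliers ::
  "(nat \<Rightarrow> real) \<Rightarrow> (nat \<Rightarrow> nat) \<Rightarrow> (nat \<Rightarrow> real) \<Rightarrow> nat \<Rightarrow> nat \<Rightarrow> real" where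
  "approx_multipliers tau idx lam N i = step_sum tau idx lam N i / step_sum tau idx lam N 0"

end

theory Submission
  imports Defs
begin

text \<open>
  With \<open>h k = sqrt (2 * D) * tau k\<close>, both methods satisfy a common one-step estimate for every \<open>y \<in> Q\<close>,
  writing \<open>i\<close> for \<open>idx k\<close>:
  \<open>\<beta>(x\<^sub>k\<^sub>+\<^sub>1, y) \<le> \<beta>(x\<^sub>k, y) + \<lambda>\<^sub>k f\<^sub>i(y) - h\<^sub>k\<^sup>2/2\<close> if \<open>i > 0\<close>, and
  \<open>\<beta>(x\<^sub>k\<^sub>+\<^sub>1, y) \<le> \<beta>(x\<^sub>k, y) + \<lambda>\<^sub>k (f\<^sub>0(y) - f\<^sub>0(x\<^sub>k)) + h\<^sub>k\<^sup>2/2\<close> if \<open>i = 0\<close>.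
  Moreover, if \<open>i = 0\<close>, then \<open>h\<^sub>k \<le> \<lambda>\<^sub>k M\<^sub>0\<close> and \<open>f\<^sub>j(x\<^sub>k) \<le> M\<^sub>j h\<^sub>k\<close> for all constraints \<open>j\<close>. Over the
  window \<open>k(N), \<dots>, N - 1\<close> the numbers \<open>h\<^sub>k\<^sup>2/2\<close> add up to at least \<open>D\<close>, which exceeds the initial
  Bregman distance; hence
  \<open>\<Sum>\<^sub>i \<sigma>\<^sub>i f\<^sub>i(y) > \<Sum> (\<lambda>\<^sub>k f\<^sub>0(x\<^sub>k) - h\<^sub>k\<^sup>2)\<close>, the right-hand sum ranging over the steps with \<open>i = 0\<close>.
  At \<open>y = x\<^sup>*\<close> this rules out \<open>\<sigma>\<^sub>0 = 0\<close>; after division by \<open>\<sigma>\<^sub>0\<close> it bounds the dual function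
  from below. Finally \<open>f\<^sub>0(x\<^sup>*) - f\<^sub>0(x\<^sub>k) \<le> \<Sum>\<^sub>j \<lambda>\<^sup>*\<^sub>j f\<^sub>j(x\<^sub>k)\<close> by strong duality.
\<close>

section \<open>Compactness in finite dimension\<close>

text \<open>The norm is compared with the maximum norm of the coordinates in a basis: on the compact
  unit sphere of coordinates the given norm is bounded away from 0, so a bounded set lies in the
  continuous image of a cube of coordinates.\<close>

lemma compact_if_closed_bounded_finite_span:
  fixes S :: "'a::real_normed_vector set"
  assumes "finite B" "span B = (UNIV :: 'a set)" "closed S" "bounded S"
  shows "compact S"
proof -
  obtain C where C: "C \<subseteq> B" "independent C" "B \<subseteq> span C"
    using maximal_independent_subset[of B] by blast
  have finC: "finite C" using C(1) assms(1) finite_subset by blast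
  have spanC: "span C = UNIV"
    using span_mono[OF C(3)] assms(2) by (simp add: span_span top.extremum_unique)
  define L :: "('a \<Rightarrow> real) \<Rightarrow> 'a" where "L c = (\<Sum>b\<in>C. c b *\<^sub>R b)" for c
  \<comment> \<open>Coordinates off the basis are pinned to 0, which makes the cube a product of
    compact sets in the product topology on functions.\<close>
  define cube :: "real \<Rightarrow> ('a \<Rightarrow> real) set"
    where "cube r = PiE UNIV (\<lambda>b. if b \<in> C then {-r..r} else {0})" for r
  have cubeI: "c \<in> cube r" if "\<And>b. b \<in> C \<Longrightarrow> \<bar>c b\<bar> \<le> r" "\<And>b. b \<notin> C \<Longrightarrow> c b = 0" for c r
    using that by (auto simp: cube_def abs_le_iff minus_le_iff)
  have compact_cube: "compact (cube r)" for r
    using compactin_PiE[of "\<lambda>_. euclidean" UNIV "\<lambda>b. if b \<in> C then {-r..r} else {0::real}"]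
    by (auto simp: cube_def euclidean_product_topology)
  have contL: "continuous_on A L" for A
    unfolding L_def
    by (intro continuous_intros continuous_on_subset[OF continuous_on_product_coordinates]) auto
  define sphere :: "('a \<Rightarrow> real) set" where "sphere = cube 1 \<inter> (\<Union>b\<in>C. {c. \<bar>c b\<bar> = 1})"
  have "closed {c :: 'a \<Rightarrow> real. \<bar>c b\<bar> = 1}" for b
    by (intro closed_Collect_eq continuous_intros continuous_on_product_coordinates)
  then have "compact sphere"
    unfolding sphere_def using compact_cube finC by (intro compact_Int_closed closed_UN) auto
  then have "closed (L ` sphere)"
    using contL compact_continuous_image compact_imp_closed by blast
  moreover have "0 \<notin> L ` sphere"
  proof
    assume "0 \<in> L ` sphere"
    then obtain c b where "L c = 0" "b \<in> C" "\<bar>c b\<bar> = 1"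
      unfolding sphere_def by auto
    then show False
      using independentD[OF C(2) finC subset_refl, of c b] by (auto simp: L_def)
  qed
  ultimately obtain e where e0: "e > 0" "ball 0 e \<subseteq> - (L ` sphere)"
    by (meson ComplI openE open_Compl)
  have e: "e \<le> norm (L c)" if "c \<in> sphere" for c
  proof (rule ccontr)
    assume "\<not> e \<le> norm (L c)"
    then have "L c \<in> ball 0 e" by simp
    then show False using e0(2) that by blast
  qed
  have in_cube: "v \<in> L ` cube r" if v: "norm v \<le> e * r" and r: "0 \<le> r" for v r
  proof -
    obtain u where u: "v = (\<Sum>b\<in>C. u b *\<^sub>R b)"
      using span_finite[OF finC] unfolding spanC by blast
    define c where "c b = (if b \<in> C then u b else 0)" for b
    have vc: "v = L c" unfolding u L_def c_def by (intro sum.cong) auto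
    have "\<bar>c b\<bar> \<le> r" if b: "b \<in> C" for b
    proof -
      \<comment> \<open>\<open>mu\<close> is the maximum norm of \<open>c\<close>. If it is nonzero,
        dividing by it moves \<open>c\<close> onto the sphere, where the lower bound
        \<open>e\<close> applies; this gives \<open>mu \<le> r\<close>.\<close>
      define mu where "mu = Max ((\<lambda>b. \<bar>c b\<bar>) ` C)"
      have le: "\<bar>c a\<bar> \<le> mu" if "a \<in> C" for a
        unfolding mu_def using finC that by auto
      have "mu \<in> (\<lambda>b. \<bar>c b\<bar>) ` C"
        unfolding mu_def using finC b by (intro Max_in) auto
      then obtain a where a: "a \<in> C" "mu = \<bar>c a\<bar>" by blast
      show ?thesis
      proof (cases "mu = 0")
        case True
        then show ?thesis using le[OF b] r by simp
      next
        case False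
        then have mu: "mu > 0" using a by simp
        have "\<bar>c b / mu\<bar> \<le> 1" if "b \<in> C" for b
          using mu le[OF that] by simp
        then have "(\<lambda>b. c b / mu) \<in> cube 1"
          by (intro cubeI) (auto simp: c_def)
        moreover have "\<bar>c a / mu\<bar> = 1" using mu a(2) by simp
        ultimately have "(\<lambda>b. c b / mu) \<in> sphere"
          unfolding sphere_def using a(1) by blast
        then have "e \<le> norm (L (\<lambda>b. c b / mu))" by (rule e)
        also have "L (\<lambda>b. c b / mu) = (1 / mu) *\<^sub>R L c"
          unfolding L_def by (simp add: scaleR_sum_right divide_inverse mult.commute)
        also have "norm \<dots> = norm v / mu" using mu vc by simp
        finally have "e * mu \<le> e * r" using mu v by (simp add: field_simps)
        then show ?thesis using e0(1) le[OF b] by simp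
      qed
    qed
    then have "c \<in> cube r" by (intro cubeI) (auto simp: c_def)
    then show ?thesis using vc by blast
  qed
  obtain R where R: "R > 0" "\<And>v. v \<in> S \<Longrightarrow> norm v \<le> R"
    using assms(4) bounded_pos by blast
  have "S \<subseteq> L ` cube (R / e)"
    using in_cube[of _ "R / e"] R e0(1) by auto
  moreover have "compact (L ` cube (R / e))"
    using contL compact_cube compact_continuous_image by blast
  ultimately show ?thesis
    using assms(3) compact_Int_closed[of "L ` cube (R / e)" S] by (simp add: Int_absorb1)
qed

section \<open>First-order optimality and Bregman steps\<close>

text \<open>Along the segment from \<open>T\<close> to \<open>y\<close>, a positive derivative at
  \<open>T\<close> would give larger values of \<open>psi\<close> at nearby points, which convexity
  keeps in \<open>Q\<close>.\<close>

lemma convex_max_first_order: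
  fixes psi :: "'a::real_normed_vector \<Rightarrow> real"
  assumes "convex Q" "T \<in> Q" "y \<in> Q"
    and deriv: "(psi has_derivative psi') (at T)"
    and max: "\<And>z. z \<in> Q \<Longrightarrow> psi z \<le> psi T"
  shows "psi' (y - T) \<le> 0"
proof (rule ccontr)
  assume "\<not> psi' (y - T) \<le> 0"
  then have pos: "psi' (y - T) > 0" by simp
  have "((\<lambda>t. psi (T + t *\<^sub>R (y - T))) has_derivative (\<lambda>t. psi' (t *\<^sub>R (y - T)))) (at (0::real))"
    by (rule has_derivative_compose[of "\<lambda>t. T + t *\<^sub>R (y - T)" "\<lambda>t. t *\<^sub>R (y - T)" 0 UNIV psi psi'])
      (auto intro!: derivative_eq_intros simp: deriv)
  then have "DERIV (\<lambda>t. psi (T + t *\<^sub>R (y - T))) 0 :> psi' (y - T)"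
    using linear_scale[OF has_derivative_linear[OF deriv]]
    by (auto simp: has_field_derivative_def mult.commute elim!: has_derivative_eq_rhs)
  from DERIV_pos_inc_right[OF this pos] obtain \<delta> where "\<delta> > 0"
    and inc: "\<And>t. 0 < t \<Longrightarrow> t < \<delta> \<Longrightarrow> psi T < psi (T + t *\<^sub>R (y - T))"
    by auto
  define t where "t = min (\<delta> / 2) 1"
  have t: "0 < t" "t < \<delta>" "t \<le> 1" using \<open>\<delta> > 0\<close> by (auto simp: t_def)
  have "T + t *\<^sub>R (y - T) = (1 - t) *\<^sub>R T + t *\<^sub>R y" by (simp add: algebra_simps)
  also have "\<dots> \<in> Q" using assms(1-3) t by (intro convexD) auto
  finally show False using max inc[OF t(1,2)] by fastforce
qed

lemma prox_function_continuous_on: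
  assumes "prox_function U d gd" "Q \<subseteq> U"
  shows "continuous_on Q d"
  using assms unfolding prox_function_def
  by (meson continuous_at_imp_continuous_on has_derivative_continuous subsetD)

lemma continuous_on_bregman:
  assumes "prox_function U d gd" "Q \<subseteq> U"
  shows "continuous_on Q (bregman d gd x)"
  unfolding bregman_def[abs_def]
  by (intro continuous_intros prox_function_continuous_on[OF assms])

lemma bregman_ge:
  assumes "prox_function U d gd" "Q \<subseteq> U" "x \<in> Q" "y \<in> Q"
  shows "(norm (y - x))\<^sup>2 / 2 \<le> bregman d gd x y"
  using assms unfolding prox_function_def bregman_def by (smt (verit) subsetD)

text \<open>The Bregman analogue of the law of cosines: it turns an optimality condition at
  \<open>T\<close> into a decrease of the distance to \<open>y\<close>.\<close>

lemma bregman_three_point: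
  "bregman d gd T y = bregman d gd x y - bregman d gd x T - (gd T - gd x) (y - T)"
  by (simp add: bregman_def blinfun.diff_left blinfun.diff_right algebra_simps)

lemma arg_max_on_attained:
  fixes psi :: "'a::topological_space \<Rightarrow> real"
  assumes "compact Q" "Q \<noteq> {}" "continuous_on Q psi"
  shows "arg_max_on psi Q \<in> Q" "\<And>z. z \<in> Q \<Longrightarrow> psi z \<le> psi (arg_max_on psi Q)"
proof -
  have "\<exists>T. is_arg_max psi (\<lambda>z. z \<in> Q) T"
    using continuous_attains_sup[OF assms] by (auto simp: is_arg_max_def not_less)
  then have "is_arg_max psi (\<lambda>z. z \<in> Q) (arg_max_on psi Q)"
    unfolding arg_max_on_def arg_max_def by (rule someI_ex)
  then show "arg_max_on psi Q \<in> Q" "\<And>z. z \<in> Q \<Longrightarrow> psi z \<le> psi (arg_max_on psi Q)"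
    by (auto simp: is_arg_max_def not_less)
qed

lemma arg_min_on_attained:
  fixes psi :: "'a::topological_space \<Rightarrow> real"
  assumes "compact Q" "Q \<noteq> {}" "continuous_on Q psi"
  shows "arg_min_on psi Q \<in> Q"
proof -
  have "\<exists>T. is_arg_min psi (\<lambda>z. z \<in> Q) T"
    using continuous_attains_inf[OF assms] by (auto simp: is_arg_min_def not_less)
  then have "is_arg_min psi (\<lambda>z. z \<in> Q) (arg_min_on psi Q)"
    unfolding arg_min_on_def arg_min_def by (rule someI_ex)
  then show ?thesis by (simp add: is_arg_min_def)
qed

text \<open>First-order optimality of the maximizer bounds the gradient term of the three-point
  identity by \<open>l * g (y - T)\<close>; what remains at \<open>T\<close> is the maximal value
  itself, that is \<open>prox_max\<close>.\<close>

lemma prox_step_bound: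
  fixes g :: "'a::real_normed_vector \<Rightarrow>\<^sub>L real" and x :: 'a and l :: real
  assumes "compact Q" "convex Q" "prox_function U d gd" "Q \<subseteq> U" "Q \<noteq> {}"
  defines "T \<equiv> prox_step Q d gd g x l"
  shows "T \<in> Q"
    and "\<And>y. y \<in> Q \<Longrightarrow> bregman d gd T y \<le> bregman d gd x y - l * g (x - y) + prox_max Q d gd g x l"
proof -
  define psi where "psi z = l * g (x - z) - bregman d gd x z" for z
  have T_arg: "T = arg_max_on psi Q"
    unfolding T_def prox_step_def psi_def[abs_def] ..
  have cont: "continuous_on Q psi"
    unfolding psi_def[abs_def] by (intro continuous_intros continuous_on_bregman[OF assms(3,4)])
  note attained = arg_max_on_attained[OF assms(1,5) cont, folded T_arg]
  show TQ: "T \<in> Q" by (rule attained(1))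
  have max: "prox_max Q d gd g x l = psi T"
    unfolding prox_max_def psi_def[symmetric] using attained by (intro cSup_eq_maximum) auto
  have "(d has_derivative blinfun_apply (gd T)) (at T)"
    using assms(3,4) TQ unfolding prox_function_def by blast
  then have deriv: "(psi has_derivative (\<lambda>v. - l * g v - (gd T v - gd x v))) (at T)"
    unfolding psi_def[abs_def] bregman_def
    by (auto intro!: derivative_eq_intros bounded_linear.has_derivative[OF blinfun.bounded_linear_right]
        simp: blinfun.minus_right)
  fix y assume y: "y \<in> Q"
  have "- l * g (y - T) - (gd T (y - T) - gd x (y - T)) \<le> 0"
    by (rule convex_max_first_order[OF assms(2) TQ y deriv]) (rule attained(2))
  then have "- ((gd T - gd x) (y - T)) \<le> l * g (y - T)"
    by (simp add: blinfun.diff_left)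
  then show "bregman d gd T y \<le> bregman d gd x y - l * g (x - y) + prox_max Q d gd g x l"
    unfolding max psi_def bregman_three_point[of d gd T y x]
    by (simp add: blinfun.diff_right algebra_simps)
qed

text \<open>Strong convexity leaves the quadratic \<open>l * M * t - t\<^sup>2 / 2\<close> in
  \<open>t = norm (x - T)\<close>; completing the square bounds it.\<close>

lemma prox_max_le:
  assumes "prox_function U d gd" "Q \<subseteq> U" "x \<in> Q" "norm g \<le> M" "0 \<le> l"
  shows "prox_max Q d gd g x l \<le> (l * M)\<^sup>2 / 2"
  unfolding prox_max_def
proof (rule cSUP_least)
  show "Q \<noteq> {}" using assms(3) by blast
  fix T assume T: "T \<in> Q"
  have "g (x - T) \<le> norm g * norm (x - T)"
    using norm_blinfun[of g "x - T"] by simp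
  also have "\<dots> \<le> M * norm (x - T)" using assms(4) by (simp add: mult_right_mono)
  finally have "l * g (x - T) \<le> l * M * norm (x - T)"
    using assms(5) by (simp add: mult_left_mono mult.assoc)
  moreover have "0 \<le> (l * M - norm (x - T))\<^sup>2" by simp
  ultimately show "l * g (x - T) - bregman d gd x T \<le> (l * M)\<^sup>2 / 2"
    using bregman_ge[OF assms(1-3) T] by (simp add: power2_diff norm_minus_commute)
qed

text \<open>The equation for \<open>l\<close> fixes the value of \<open>prox_max\<close>, which the
  previous bound keeps small for small \<open>l\<close>; so the step size cannot be too
  short.\<close>

lemma step_size_ge:
  assumes "prox_function U d gd" "Q \<subseteq> U" "x \<in> Q" "norm g \<le> M" "is_step_size Q d gd g x h l"
  shows "h \<le> l * M"
proof -
  have l: "l > 0" "prox_max Q d gd g x l = h\<^sup>2 / 2" using assms(5) by (auto simp: is_step_size_def)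
  have "0 \<le> M" by (rule order_trans[OF norm_ge_zero assms(4)])
  then show ?thesis
    using prox_max_le[OF assms(1-4), of l] l by (auto intro: power2_le_imp_le)
qed

text \<open>Here the multiplier condition takes the place of the first-order argument, and
  complementary slackness turns \<open>l * g (y - T)\<close> into
  \<open>l * (v + g (y - x))\<close>. Nonemptiness of the cut makes the choice in
  \<open>cut_proj\<close> a true minimizer.\<close>

lemma cut_proj_bound:
  fixes g :: "'a::real_normed_vector \<Rightarrow>\<^sub>L real" and x :: 'a and v :: real
  assumes "compact Q" "prox_function U d gd" "Q \<subseteq> U" "{T\<in>Q. v + g (T - x) \<le> 0} \<noteq> {}"
  defines "T \<equiv> cut_proj Q d gd v g x"
  shows "T \<in> Q" "v + g (T - x) \<le> 0"
    and "\<And>y. is_cut_multiplier Q d gd v g x l \<Longrightarrow> y \<in> Q \<Longrightarrow>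
      bregman d gd T y \<le> bregman d gd x y - bregman d gd x T + l * (v + g (y - x))"
proof -
  have "closed {T. v + g (T - x) \<le> 0}"
    by (intro closed_Collect_le continuous_intros)
  moreover have "{T\<in>Q. v + g (T - x) \<le> 0} = Q \<inter> {T. v + g (T - x) \<le> 0}" by blast
  ultimately have "compact {T\<in>Q. v + g (T - x) \<le> 0}"
    using assms(1) compact_Int_closed by metis
  then have "T \<in> {T\<in>Q. v + g (T - x) \<le> 0}"
    unfolding T_def cut_proj_def
    using assms(3,4) by (intro arg_min_on_attained continuous_on_bregman[OF assms(2)]) auto
  then show "T \<in> Q" "v + g (T - x) \<le> 0" by auto
  fix y assume "is_cut_multiplier Q d gd v g x l" "y \<in> Q"
  then have "0 \<le> (gd T - gd x + l *\<^sub>R g) (y - T)" "l * (v + g (T - x)) = 0"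
    unfolding is_cut_multiplier_def T_def Let_def by auto
  then show "bregman d gd T y \<le> bregman d gd x y - bregman d gd x T + l * (v + g (y - x))"
    unfolding bregman_three_point[of d gd T y x]
    by (simp add: blinfun.diff_right blinfun.diff_left blinfun.add_left blinfun.scaleR_left algebra_simps)
qed

section \<open>One step of either method\<close>

text \<open>The common interface through which both methods enter the final argument. The
  conditional summand merges the two one-step estimates: for \<open>i = 0\<close> it changes
  \<open>- h\<^sup>2 / 2\<close> into \<open>h\<^sup>2 / 2 - l * f 0 x\<close>.\<close>

definition switching_step ::
  "'a::real_normed_vector set \<Rightarrow> nat \<Rightarrow> (nat \<Rightarrow> 'a \<Rightarrow> real) \<Rightarrow> ('a \<Rightarrow> real) \<Rightarrow> ('a \<Rightarrow> 'a \<Rightarrow>\<^sub>L real) \<Rightarrow>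
   (nat \<Rightarrow> real) \<Rightarrow> real \<Rightarrow> 'a \<Rightarrow> nat \<Rightarrow> real \<Rightarrow> 'a \<Rightarrow> bool" where
  "switching_step Q m f d gd M h x i l z \<longleftrightarrow>
     z \<in> Q \<and> 0 \<le> l \<and> i \<le> m \<and>
     (\<forall>y\<in>Q. bregman d gd z y \<le> bregman d gd x y + l * f i y - h\<^sup>2 / 2
                + (if i = 0 then h\<^sup>2 - l * f 0 x else 0)) \<and>
     (i = 0 \<longrightarrow> 0 < l \<and> h \<le> l * M 0 \<and> (\<forall>j\<in>{1..m}. f j x \<le> M j * h))"

text \<open>Objective steps are the same in both methods; only the reason for the bound on the
  constraints differs, so that bound is an assumption here.\<close>

lemma switching_step_objective:
  assumes "compact Q" "convex Q" "prox_function U d gd" "Q \<subseteq> U" "x \<in> Q"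
    and sub: "is_subgradient Q (f 0) (f' 0 x) x"
    and "norm (f' 0 x) \<le> M 0"
    and step: "is_step_size Q d gd (f' 0 x) x h l"
    and con: "\<And>j. j \<in> {1..m} \<Longrightarrow> f j x \<le> M j * h"
  shows "switching_step Q m f d gd M h x 0 l (prox_step Q d gd (f' 0 x) x l)"
proof -
  have l: "l > 0" "prox_max Q d gd (f' 0 x) x l = h\<^sup>2 / 2"
    using step by (auto simp: is_step_size_def)
  have "Q \<noteq> {}" using assms(5) by blast
  note T = prox_step_bound[OF assms(1-4) this, where g = "f' 0 x" and x = x and l = l]
  have "bregman d gd (prox_step Q d gd (f' 0 x) x l) y
      \<le> bregman d gd x y + l * f 0 y - h\<^sup>2 / 2 + (h\<^sup>2 - l * f 0 x)" if y: "y \<in> Q" for y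
  proof -
    have "f 0 x + f' 0 x (y - x) \<le> f 0 y" using sub y by (simp add: is_subgradient_def)
    then have "l * (f 0 x + f' 0 x (y - x)) \<le> l * f 0 y" using l(1) by simp
    then show ?thesis
      using T(2)[OF y] l(2) by (simp add: blinfun.diff_right algebra_simps)
  qed
  then show ?thesis
    unfolding switching_step_def
    using T(1) l(1) con step_size_ge[OF assms(3-5,7) step] by simp
qed

text \<open>In a constraint step the decrease is the distance from \<open>x k\<close> to its
  projection, which the test makes at least \<open>(h k)\<^sup>2 / 2\<close>. The feasible point
  \<open>xs\<close> keeps all cuts nonempty.\<close>

lemma switching_step_method_I:
  assumes "compact Q" "convex Q" "prox_function U d gd" "Q \<subseteq> U" "0 \<le> h k"
    and sub: "\<And>i y. i \<le> m \<Longrightarrow> y \<in> Q \<Longrightarrow> is_subgradient Q (f i) (f' i y) y"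
    and M: "\<And>i y. i \<le> m \<Longrightarrow> y \<in> Q \<Longrightarrow> norm (f' i y) \<le> M i"
    and feasible: "xs \<in> feasible_set Q m f"
    and gen: "method_I Q m f f' d gd h x idx lam"
    and x: "x k \<in> Q"
  shows "switching_step Q m f d gd M (h k) (x k) (idx k) (lam k) (x (Suc k))"
proof -
  define That where "That i = cut_proj Q d gd (f i (x k)) (f' i (x k)) (x k)" for i
  have nonempty: "{T\<in>Q. f i (x k) + f' i (x k) (T - x k) \<le> 0} \<noteq> {}" if "i \<in> {1..m}" for i
  proof -
    have "xs \<in> Q" "f i xs \<le> 0" using feasible that by (auto simp: feasible_set_def)
    moreover have "f i (x k) + f' i (x k) (xs - x k) \<le> f i xs"
      using sub[of i "x k"] x that \<open>xs \<in> Q\<close> by (simp add: is_subgradient_def)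
    ultimately show ?thesis by force
  qed
  note cut = cut_proj_bound[OF assms(1,3,4) nonempty, folded That_def]
  have gen_k: "if \<exists>i\<in>{1..m}. bregman d gd (x k) (That i) \<ge> (h k)\<^sup>2 / 2
      then idx k \<in> {1..m} \<and> bregman d gd (x k) (That (idx k)) \<ge> (h k)\<^sup>2 / 2 \<and>
        is_cut_multiplier Q d gd (f (idx k) (x k)) (f' (idx k) (x k)) (x k) (lam k) \<and>
        x (Suc k) = That (idx k)
      else idx k = 0 \<and> is_step_size Q d gd (f' 0 (x k)) (x k) (h k) (lam k) \<and>
        x (Suc k) = prox_step Q d gd (f' 0 (x k)) (x k) (lam k)"
    using gen unfolding method_I_def That_def Let_def by blast
  show ?thesis
  proof (cases "\<exists>i\<in>{1..m}. bregman d gd (x k) (That i) \<ge> (h k)\<^sup>2 / 2")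
    case True
    then have i: "idx k \<in> {1..m}" "bregman d gd (x k) (That (idx k)) \<ge> (h k)\<^sup>2 / 2"
      "is_cut_multiplier Q d gd (f (idx k) (x k)) (f' (idx k) (x k)) (x k) (lam k)"
      "x (Suc k) = That (idx k)"
      using gen_k by auto
    have lam: "0 \<le> lam k" using i(3) by (simp add: is_cut_multiplier_def)
    have "bregman d gd (That (idx k)) y \<le> bregman d gd (x k) y + lam k * f (idx k) y - (h k)\<^sup>2 / 2"
      if y: "y \<in> Q" for y
    proof -
      have "f (idx k) (x k) + f' (idx k) (x k) (y - x k) \<le> f (idx k) y"
        using sub[of "idx k" "x k"] x i(1) y by (simp add: is_subgradient_def)
      then have "lam k * (f (idx k) (x k) + f' (idx k) (x k) (y - x k)) \<le> lam k * f (idx k) y"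
        using lam by (rule mult_left_mono)
      then show ?thesis using cut(3)[OF i(1) i(3) y] i(2) by linarith
    qed
    then show ?thesis
      unfolding switching_step_def using i(1,4) lam cut(1)[OF i(1)] by auto
  next
    case False
    then have z: "idx k = 0" "is_step_size Q d gd (f' 0 (x k)) (x k) (h k) (lam k)"
      "x (Suc k) = prox_step Q d gd (f' 0 (x k)) (x k) (lam k)"
      using gen_k by auto
    have "f j (x k) \<le> M j * h k" if j: "j \<in> {1..m}" for j
    proof -
      have Mj: "norm (f' j (x k)) \<le> M j" using M j x by simp
      \<comment> \<open>A failed test and strong convexity place the projection within
        \<open>h k\<close> of \<open>x k\<close>. The linearized constraint holds there, so
        \<open>f j (x k)\<close> is at most the dual norm of the subgradient times this
        distance.\<close>
      have "(norm (That j - x k))\<^sup>2 \<le> (h k)\<^sup>2"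
        using False j bregman_ge[OF assms(3,4) x cut(1)[OF j]] by force
      then have "norm (That j - x k) \<le> h k" using assms(5) by (rule power2_le_imp_le)
      then have bound: "norm (f' j (x k)) * norm (That j - x k) \<le> M j * h k"
        using Mj assms(5) order_trans[OF norm_ge_zero Mj] by (intro mult_mono) auto
      have "f j (x k) \<le> - (f' j (x k) (That j - x k))" using cut(2)[OF j] by simp
      also have "\<dots> \<le> norm (f' j (x k)) * norm (That j - x k)"
        using norm_blinfun[of "f' j (x k)" "That j - x k"] by simp
      finally show ?thesis using bound by simp
    qed
    then show ?thesis
      unfolding z(1,3)
      by (intro switching_step_objective[OF assms(1-4) x] sub M x z(2)) auto
  qed
qed

text \<open>In a constraint step the prox step costs \<open>(h k)\<^sup>2 / 2\<close>, while the
  test yields a gain of at least \<open>(h k)\<^sup>2\<close>; the difference is the required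
  decrease.\<close>

lemma switching_step_method_II:
  assumes "compact Q" "convex Q" "prox_function U d gd" "Q \<subseteq> U" "0 \<le> h k"
    and sub: "\<And>i y. i \<le> m \<Longrightarrow> y \<in> Q \<Longrightarrow> is_subgradient Q (f i) (f' i y) y"
    and M: "\<And>i y. i \<le> m \<Longrightarrow> y \<in> Q \<Longrightarrow> norm (f' i y) \<le> M i"
    and gen: "method_II Q m f f' d gd h x idx lam"
    and x: "x k \<in> Q"
  shows "switching_step Q m f d gd M (h k) (x k) (idx k) (lam k) (x (Suc k))"
proof -
  obtain l where l: "\<And>i. i \<in> {1..m} \<Longrightarrow> is_step_size Q d gd (f' i (x k)) (x k) (h k) (l i)"
    and cases: "if \<exists>i\<in>{1..m}. l i * f i (x k) \<ge> (h k)\<^sup>2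
         then idx k \<in> {1..m} \<and> l (idx k) * f (idx k) (x k) \<ge> (h k)\<^sup>2
         else idx k = 0 \<and> is_step_size Q d gd (f' 0 (x k)) (x k) (h k) (l 0)"
    and lam: "lam k = l (idx k)"
    and step: "x (Suc k) = prox_step Q d gd (f' (idx k) (x k)) (x k) (lam k)"
    using gen unfolding method_II_def by blast
  show ?thesis
  proof (cases "\<exists>i\<in>{1..m}. l i * f i (x k) \<ge> (h k)\<^sup>2")
    case True
    then have i: "idx k \<in> {1..m}" "lam k * f (idx k) (x k) \<ge> (h k)\<^sup>2"
      using cases lam by auto
    have ss: "lam k > 0" "prox_max Q d gd (f' (idx k) (x k)) (x k) (lam k) = (h k)\<^sup>2 / 2"
      using l[OF i(1)] lam by (auto simp: is_step_size_def)
    have "Q \<noteq> {}" using x by blast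
    note T = prox_step_bound[OF assms(1-4) this, where g = "f' (idx k) (x k)" and x = "x k" and l = "lam k", folded step]
    have "bregman d gd (x (Suc k)) y \<le> bregman d gd (x k) y + lam k * f (idx k) y - (h k)\<^sup>2 / 2"
      if y: "y \<in> Q" for y
    proof -
      have "f (idx k) (x k) + f' (idx k) (x k) (y - x k) \<le> f (idx k) y"
        using sub[of "idx k" "x k"] x i(1) y by (simp add: is_subgradient_def)
      then have "lam k * (f (idx k) (x k) + f' (idx k) (x k) (y - x k)) \<le> lam k * f (idx k) y"
        using ss(1) by simp
      then show ?thesis
        using T(2)[OF y] ss(2) i(2) by (simp add: blinfun.diff_right algebra_simps)
    qed
    then show ?thesis unfolding switching_step_def using T(1) ss(1) i(1) by auto
  next
    case False
    then have z: "idx k = 0" "is_step_size Q d gd (f' 0 (x k)) (x k) (h k) (lam k)"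
      using cases lam by auto
    have "f j (x k) \<le> M j * h k" if j: "j \<in> {1..m}" for j
    proof (rule ccontr)
      assume "\<not> f j (x k) \<le> M j * h k"
      then have *: "M j * h k < f j (x k)" by simp
      have lj: "l j > 0" using l[OF j] by (simp add: is_step_size_def)
      \<comment> \<open>With this lower bound on \<open>l j\<close>, a violation above
        \<open>M j * h k\<close> would have passed the test.\<close>
      have "h k \<le> l j * M j"
        using step_size_ge[OF assms(3,4) x M l[OF j]] j x by simp
      then have "h k * h k \<le> l j * M j * h k" using assms(5) by (rule mult_right_mono)
      also have "\<dots> \<le> l j * f j (x k)" using * lj by simp
      finally show False using False j by (auto simp: power2_eq_square)
    qed
    then show ?thesis
      unfolding step z(1)
      by (intro switching_step_objective[OF assms(1-4) x] sub M x z(2)) auto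
  qed
qed

section \<open>Divergence delay and summation window\<close>

text \<open>Divergence of the partial sums supplies a candidate for \<open>LEAST\<close>, which the
  operator needs in order to be meaningful.\<close>

lemma divergence_delay_ge_1:
  assumes "filterlim (\<lambda>n. \<Sum>k<n. (tau k)\<^sup>2) at_top sequentially"
  shows "1 \<le> (\<Sum>i=k..k + divergence_delay tau k. (tau i)\<^sup>2)"
proof -
  have "\<forall>\<^sub>F n in sequentially. (\<Sum>i<k. (tau i)\<^sup>2) + 1 \<le> (\<Sum>i<n. (tau i)\<^sup>2)"
    using assms by (simp add: filterlim_at_top)
  then obtain n where n: "n > k" "(\<Sum>i<k. (tau i)\<^sup>2) + 1 \<le> (\<Sum>i<n. (tau i)\<^sup>2)"
    by (metis (mono_tags, lifting) eventually_at_top_dense eventually_conj eventually_gt_at_top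
        eventually_happens sequentially_bot)
  have "(\<Sum>i<n. (tau i)\<^sup>2) = (\<Sum>i\<in>{0..<k}. (tau i)\<^sup>2) + (\<Sum>i\<in>{k..<n}. (tau i)\<^sup>2)"
    using n(1) by (simp add: sum.atLeastLessThan_concat lessThan_atLeast0)
  \<comment> \<open>Partial sums stop before \<open>n\<close>, while the delay counts a closed
    interval; hence the witness \<open>n - 1 - k\<close>.\<close>
  moreover have "{k..<n} = {k..k + (n - 1 - k)}" using n(1) by auto
  ultimately have "1 \<le> (\<Sum>i=k..k + (n - 1 - k). (tau i)\<^sup>2)"
    using n(2) by (simp add: lessThan_atLeast0)
  then have "\<exists>a. 1 \<le> (\<Sum>i=k..k + a. (tau i)\<^sup>2)" ..
  then show ?thesis unfolding divergence_delay_def by (rule LeastI_ex)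
qed

text \<open>The bound on \<open>N\<close> puts 0 into the set under \<open>Max\<close>, whose
  members are at most \<open>N - 1\<close>, so the maximum is attained. The window then contains a
  full delay interval.\<close>

lemma start_index_window:
  assumes div: "filterlim (\<lambda>n. \<Sum>k<n. (tau k)\<^sup>2) at_top sequentially"
    and N: "N \<ge> 1 + divergence_delay tau 0"
  shows "start_index tau N \<le> N - 1" "1 \<le> (\<Sum>k=start_index tau N..N - 1. (tau k)\<^sup>2)"
proof -
  let ?s = "start_index tau N"
  have "?s \<in> {k. k + divergence_delay tau k \<le> N - 1}"
    unfolding start_index_def
  proof (rule Max_in)
    show "finite {k. k + divergence_delay tau k \<le> N - 1}"
      by (rule finite_subset[of _ "{..N - 1}"]) auto
    show "{k. k + divergence_delay tau k \<le> N - 1} \<noteq> {}" using N by (auto intro!: exI[of _ 0])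
  qed
  then have s: "?s + divergence_delay tau ?s \<le> N - 1" by simp
  then show "?s \<le> N - 1" by simp
  have "1 \<le> (\<Sum>i=?s..?s + divergence_delay tau ?s. (tau i)\<^sup>2)"
    by (rule divergence_delay_ge_1[OF div])
  also have "\<dots> \<le> (\<Sum>k=?s..N - 1. (tau k)\<^sup>2)" using s by (intro sum_mono2) auto
  finally show "1 \<le> (\<Sum>k=?s..N - 1. (tau k)\<^sup>2)" .
qed

section \<open>Lower bounds and the dual function\<close>

text \<open>An affine minorant is bounded below on a bounded set. This makes the real-valued
  \<open>INF\<close> in \<open>dual_fun\<close> a genuine infimum for nonnegative
  multipliers.\<close>

lemma subgradient_bdd_below:
  assumes "bounded Q" "x \<in> Q" "is_subgradient Q f g x"
  shows "bdd_below (f ` Q)"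
proof -
  obtain R where R: "\<And>y. y \<in> Q \<Longrightarrow> norm y \<le> R" using assms(1) bounded_iff by blast
  have "f x - norm g * (R + norm x) \<le> f y" if y: "y \<in> Q" for y
  proof -
    have "norm (y - x) \<le> R + norm x" using R[OF y] norm_triangle_ineq4[of y x] by linarith
    then have "norm g * norm (y - x) \<le> norm g * (R + norm x)" by (simp add: mult_left_mono)
    moreover have "- (g (y - x)) \<le> norm g * norm (y - x)" using norm_blinfun[of g "y - x"] by simp
    moreover have "f x + g (y - x) \<le> f y" using assms(3) y by (simp add: is_subgradient_def)
    ultimately show ?thesis by linarith
  qed
  then show ?thesis by (rule bdd_belowI2)
qed

lemma dual_fun_le:
  assumes bdd: "\<And>i. i \<le> m \<Longrightarrow> bdd_below (f i ` Q)" and l: "l \<in> nonneg_orthant m" and y: "y \<in> Q"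
  shows "dual_fun Q m f l \<le> f 0 y + (\<Sum>i=1..m. l i * f i y)"
proof -
  obtain b where b: "\<And>i z. i \<le> m \<Longrightarrow> z \<in> Q \<Longrightarrow> b i \<le> f i z"
    using bdd unfolding bdd_below_def by (metis imageI)
  have "b 0 + (\<Sum>i=1..m. l i * b i) \<le> f 0 z + (\<Sum>i=1..m. l i * f i z)" if "z \<in> Q" for z
    using that l by (intro add_mono sum_mono mult_left_mono b) (auto simp: nonneg_orthant_def)
  then show ?thesis
    unfolding dual_fun_def using y by (intro cINF_lower bdd_belowI2) auto
qed

section \<open>Summation over the window and the duality gap\<close>

theorem theorem6:
  fixes Q :: "'a::real_normed_vector set"
    and m :: nat
    and f :: "nat \<Rightarrow> 'a \<Rightarrow> real"
    and f' :: "nat \<Rightarrow> 'a \<Rightarrow> 'a \<Rightarrow>\<^sub>L real"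
    and U :: "'a set"
    and d :: "'a \<Rightarrow> real"
    and gd :: "'a \<Rightarrow> 'a \<Rightarrow>\<^sub>L real"
    and D :: real
    and xstar :: 'a
    and lstar M :: "nat \<Rightarrow> real"
    and tau h :: "nat \<Rightarrow> real"
    and x :: "nat \<Rightarrow> 'a"
    and idx :: "nat \<Rightarrow> nat"
    and lam :: "nat \<Rightarrow> real"
    and N :: nat
  assumes finite_dim: "\<exists>B :: 'a set. finite B \<and> span B = UNIV"
    and Q: "closed Q" "convex Q" "bounded Q"
    and f_closed_convex: "\<And>i. i \<le> m \<Longrightarrow> closed (epigraph Q (f i)) \<and> convex_on Q (f i)"
    and f_subgradient: "\<And>i y. i \<le> m \<Longrightarrow> y \<in> Q \<Longrightarrow> is_subgradient Q (f i) (f' i y) y"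
    and prox: "prox_function U d gd" "Q \<subseteq> U"
    and D: "\<And>y z. y \<in> Q \<Longrightarrow> z \<in> Q \<Longrightarrow> bregman d gd y z < D"
    and primal_opt: "is_arg_min (f 0) (\<lambda>y. y \<in> feasible_set Q m f) xstar"
    and strong_duality: "(SUP l\<in>nonneg_orthant m. dual_fun Q m f l) = f 0 xstar"
    and dual_opt: "is_arg_max (dual_fun Q m f) (\<lambda>l. l \<in> nonneg_orthant m) lstar"
    and M_pos: "\<And>i. i \<le> m \<Longrightarrow> 0 < M i"
    and M_bound: "\<And>i y. i \<le> m \<Longrightarrow> y \<in> Q \<Longrightarrow> norm (f' i y) \<le> M i"
    and tau: "\<And>k. tau k \<ge> tau (Suc k)" "\<And>k. tau (Suc k) > 0"
    and tau_div: "filterlim (\<lambda>n. \<Sum>k<n. (tau k)\<^sup>2) at_top sequentially"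
    and h: "\<And>k. h k = sqrt (2 * D) * tau k"
    and generated: "method_I Q m f f' d gd h x idx lam \<or> method_II Q m f f' d gd h x idx lam"
    and N: "N \<ge> 1 + divergence_delay tau 0"
  shows "f 0 xstar - dual_fun Q m f (approx_multipliers tau idx lam N)
           \<le> (M 0 + (\<Sum>i=1..m. lstar i * M i)) * h (start_index tau N)"
  proof -
  let ?s = "start_index tau N"
  let ?K = "{?s..N - 1}"
  let ?S = "step_sum tau idx lam N"
  let ?A = "step_indices tau idx N 0"
  have compactQ: "compact Q"
    using compact_if_closed_bounded_finite_span finite_dim Q by blast
  have xs: "xstar \<in> Q" "\<And>i. i \<in> {1..m} \<Longrightarrow> f i xstar \<le> 0" "xstar \<in> feasible_set Q m f"
    using primal_opt by (auto simp: is_arg_min_def feasible_set_def)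
  have D_pos: "D > 0" using D[OF xs(1) xs(1)] by (simp add: bregman_def)
  have tau_pos: "tau k > 0" for k using tau by (metis less_le_trans)
  have h_pos: "h k > 0" for k using D_pos tau_pos by (simp add: h)
  have h_mono: "h k \<le> h ?s" if "?s \<le> k" for k
    using lift_Suc_antimono_le[of tau, OF tau(1) that] D_pos by (simp add: h)
  have x0: "x 0 \<in> Q" using generated by (auto simp: method_I_def method_II_def)
  have step: "switching_step Q m f d gd M (h k) (x k) (idx k) (lam k) (x (Suc k))" if "x k \<in> Q" for k
    using generated
  proof
    assume gen: "method_I Q m f f' d gd h x idx lam"
    show ?thesis
      by (rule switching_step_method_I[OF compactQ Q(2) prox less_imp_le[OF h_pos] _ _ xs(3) gen that])
        (use f_subgradient M_bound in auto)
  next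
    assume gen: "method_II Q m f f' d gd h x idx lam"
    show ?thesis
      by (rule switching_step_method_II[OF compactQ Q(2) prox less_imp_le[OF h_pos] _ _ gen that])
        (use f_subgradient M_bound in auto)
  qed
  have xQ: "x k \<in> Q" for k
    by (induction k) (use x0 step in \<open>auto simp: switching_step_def\<close>)
  note step = step[OF xQ]
  have A: "?A = {k\<in>?K. idx k = 0}" by (auto simp: step_indices_def)
  have finA: "finite ?A" unfolding A by simp
  have s: "?s \<le> N - 1" "1 \<le> (\<Sum>k\<in>?K. (tau k)\<^sup>2)" using start_index_window[OF tau_div N] .

  \<comment> \<open>Sorting the steps of the window by index turns the sum over time into a
    Lagrangian with the unnormalized weights \<open>?S i\<close>.\<close>
  have group: "(\<Sum>k\<in>?K. lam k * f (idx k) y) = ?S 0 * f 0 y + (\<Sum>i=1..m. ?S i * f i y)" for y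
  proof -
    have "(\<Sum>k\<in>?K. lam k * f (idx k) y) = (\<Sum>i\<in>{0..m}. \<Sum>k\<in>{k\<in>?K. idx k = i}. lam k * f (idx k) y)"
      using step by (intro sum.group[symmetric]) (auto simp: switching_step_def)
    also have "\<dots> = (\<Sum>i\<in>{0..m}. ?S i * f i y)"
      by (intro sum.cong) (auto simp: step_sum_def step_indices_def sum_distrib_right intro!: sum.cong)
    also have "\<dots> = ?S 0 * f 0 y + (\<Sum>i=1..m. ?S i * f i y)" by (simp add: sum.atLeast_Suc_atMost)
    finally show ?thesis .
  qed
  \<comment> \<open>The scaling of \<open>h\<close> is chosen so that
    \<open>(h k)\<^sup>2 / 2 = D * (tau k)\<^sup>2\<close>.\<close>
  have D_le: "D \<le> (\<Sum>k\<in>?K. (h k)\<^sup>2 / 2)"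
  proof -
    have "D * 1 \<le> D * (\<Sum>k\<in>?K. (tau k)\<^sup>2)" using s(2) D_pos by (intro mult_left_mono) auto
    also have "\<dots> = (\<Sum>k\<in>?K. (h k)\<^sup>2 / 2)"
      using D_pos by (simp add: h power_mult_distrib sum_distrib_left)
    finally show ?thesis by simp
  qed
  have main: "(\<Sum>k\<in>?A. lam k * f 0 (x k) - (h k)\<^sup>2) < ?S 0 * f 0 y + (\<Sum>i=1..m. ?S i * f i y)"
    if y: "y \<in> Q" for y
  proof -
    let ?b = "\<lambda>k. bregman d gd (x k) y"
    let ?c = "\<lambda>k. if idx k = 0 then (h k)\<^sup>2 - lam k * f 0 (x k) else 0"
    \<comment> \<open>The differences telescope from \<open>?s\<close> to
      \<open>Suc (N - 1)\<close>: the last distance is nonnegative and the first is below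
      \<open>D\<close>. That strict bound is the source of the strict inequality in
      \<open>main\<close>.\<close>
    have "0 \<le> ?b (Suc (N - 1))"
      by (rule order_trans[OF _ bregman_ge[OF prox xQ y]]) simp
    then have "- D < (\<Sum>k\<in>?K. ?b (Suc k) - ?b k)"
      using D[OF xQ[of ?s] y] s(1) by (subst sum_Suc_diff) auto
    also have "\<dots> \<le> (\<Sum>k\<in>?K. lam k * f (idx k) y - (h k)\<^sup>2 / 2 + ?c k)"
      using step y unfolding switching_step_def by (intro sum_mono) (smt (verit))
    also have "\<dots> = (\<Sum>k\<in>?K. lam k * f (idx k) y) - (\<Sum>k\<in>?K. (h k)\<^sup>2 / 2) + (\<Sum>k\<in>?K. ?c k)"
      by (simp add: sum.distrib sum_subtractf)
    also have "(\<Sum>k\<in>?K. ?c k) = - (\<Sum>k\<in>?A. lam k * f 0 (x k) - (h k)\<^sup>2)"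
      unfolding A sum_negf[symmetric] by (subst sum.inter_filter) (auto intro!: sum.cong)
    finally show ?thesis using D_le group by simp
  qed

  have S_nonneg: "?S i \<ge> 0" for i
    unfolding step_sum_def using step by (intro sum_nonneg) (auto simp: switching_step_def)
  have S0: "?S 0 > 0"
  proof -
    have "?A \<noteq> {}"
    proof
      assume "?A = {}"
      \<comment> \<open>Without objective steps the left side of \<open>main\<close> and
        \<open>?S 0\<close> are empty sums; strictness then contradicts feasibility of
        \<open>xstar\<close>.\<close>
      then have "0 < (\<Sum>i=1..m. ?S i * f i xstar)"
        using main[OF xs(1)] by (simp add: step_sum_def)
      moreover have "(\<Sum>i=1..m. ?S i * f i xstar) \<le> 0"
        using S_nonneg xs(2) by (intro sum_nonpos mult_nonneg_nonpos) auto
      ultimately show False by simp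
    qed
    then show ?thesis
      unfolding step_sum_def using finA step by (intro sum_pos) (auto simp: step_indices_def switching_step_def)
  qed
  have dual_ge: "(\<Sum>k\<in>?A. lam k * f 0 (x k) - (h k)\<^sup>2) / ?S 0
      \<le> dual_fun Q m f (approx_multipliers tau idx lam N)"
    unfolding dual_fun_def
  proof (rule cINF_greatest)
    show "Q \<noteq> {}" using xs(1) by blast
    fix y assume "y \<in> Q"
    from divide_right_mono[OF less_imp_le[OF main[OF this]] less_imp_le[OF S0]]
    show "(\<Sum>k\<in>?A. lam k * f 0 (x k) - (h k)\<^sup>2) / ?S 0
        \<le> f 0 y + (\<Sum>i=1..m. approx_multipliers tau idx lam N i * f i y)"
      using S0 by (simp add: approx_multipliers_def add_divide_distrib sum_divide_distrib)
  qed

  have lstar: "lstar \<in> nonneg_orthant m"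
    "\<And>l. l \<in> nonneg_orthant m \<Longrightarrow> dual_fun Q m f l \<le> dual_fun Q m f lstar"
    using dual_opt by (auto simp: is_arg_max_def not_less)
  \<comment> \<open>The dual supremum is attained at \<open>lstar\<close>, so strong duality gives
    its value there.\<close>
  have "dual_fun Q m f lstar = f 0 xstar"
    unfolding strong_duality[symmetric]
    by (rule cSup_eq_maximum[symmetric]) (use lstar in auto)
  moreover have "bdd_below (f i ` Q)" if "i \<le> m" for i
    using subgradient_bdd_below[OF Q(3) xs(1) f_subgradient[OF that xs(1)]] .
  ultimately have gap: "f 0 xstar - f 0 y \<le> (\<Sum>i=1..m. lstar i * f i y)" if "y \<in> Q" for y
    using dual_fun_le[of m f Q lstar y] lstar(1) that by fastforce
  let ?C = "M 0 + (\<Sum>i=1..m. lstar i * M i)"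
  \<comment> \<open>The claim is multiplied by \<open>?S 0\<close>, the sum of \<open>lam k\<close>
    over the objective steps, so that it can be checked step by step.\<close>
  have "?S 0 * f 0 xstar - (\<Sum>k\<in>?A. lam k * f 0 (x k) - (h k)\<^sup>2)
      = (\<Sum>k\<in>?A. lam k * (f 0 xstar - f 0 (x k)) + (h k)\<^sup>2)"
    by (simp add: step_sum_def sum_distrib_right sum_subtractf sum.distrib right_diff_distrib)
  also have "\<dots> \<le> (\<Sum>k\<in>?A. lam k * (?C * h ?s))"
  proof (rule sum_mono)
    fix k assume k: "k \<in> ?A"
    then have "idx k = 0" "?s \<le> k" by (auto simp: step_indices_def)
    then have l: "0 < lam k" "h k \<le> lam k * M 0" "\<And>j. j \<in> {1..m} \<Longrightarrow> f j (x k) \<le> M j * h k"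
      using step[of k] by (auto simp: switching_step_def)
    note mono = h_mono[OF \<open>?s \<le> k\<close>]
    \<comment> \<open>One factor \<open>h k\<close> is traded for \<open>lam k * M 0\<close> and the
      other for \<open>h ?s\<close>. The error term thereby carries the weight \<open>lam k\<close>
      and can be averaged with the rest; it contributes the \<open>M 0\<close> of the final
      constant.\<close>
    have "h k * h k \<le> (lam k * M 0) * h ?s"
      using l mono h_pos[of k] M_pos[of 0] by (intro mult_mono) auto
    moreover have "f 0 xstar - f 0 (x k) \<le> (\<Sum>i=1..m. lstar i * M i) * h ?s"
    proof -
      have "f j (x k) \<le> M j * h ?s" if "j \<in> {1..m}" for j
        using l(3)[OF that] mult_left_mono[OF mono less_imp_le[OF M_pos[of j]]] that by simp
      then have "(\<Sum>i=1..m. lstar i * f i (x k)) \<le> (\<Sum>i=1..m. lstar i * (M i * h ?s))"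
        using lstar(1) by (intro sum_mono mult_left_mono) (auto simp: nonneg_orthant_def)
      then show ?thesis using gap[OF xQ[of k]] by (simp add: sum_distrib_right mult.assoc)
    qed
    then have "lam k * (f 0 xstar - f 0 (x k)) \<le> lam k * ((\<Sum>i=1..m. lstar i * M i) * h ?s)"
      using l(1) by simp
    ultimately show "lam k * (f 0 xstar - f 0 (x k)) + (h k)\<^sup>2 \<le> lam k * (?C * h ?s)"
      by (simp add: power2_eq_square algebra_simps)
  qed
  also have "\<dots> = ?S 0 * (?C * h ?s)" by (simp add: step_sum_def sum_distrib_right)
  finally have "f 0 xstar - (\<Sum>k\<in>?A. lam k * f 0 (x k) - (h k)\<^sup>2) / ?S 0 \<le> ?C * h ?s"
    using S0 by (simp add: field_simps)
  then show ?thesis using dual_ge by linarith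
qed

end
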